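(* Let $G$ be a finite 2-edge-connected graph and $k\ge 2$ an integer. If the reconfiguration graph $\mathcal{F}(G,k)$ is non-empty, then every vertex of $\mathcal{F}(G,k)$ has degree at least $1$.
   Context: Graphs may have multiple edges but no loops. Fix an orientation $D$ of the edges of $G$. A $\mathbb{Z}$-flow in $G$ is a map $f:E(G)\to\mathbb{Z}$ such that at every vertex $v$, the sum of $f(e)$ over arcs with tail $v$ equals the sum over arcs with head $v$. A $k$-flow is a $\mathbb{Z}$-flow with $|f(e)|<k$ for all edges $e$; it is nowhere-zero if $f(e)\ne 0$ for all $e$. The support $\mathrm{supp}(f)$ is the set of edges with non-zero value. A cycle is a connected 2-regular subgraph. The reconfiguration graph $\mathcal{F}(G,k)$ has as vertices all nowhere-zero $k$-flows of $G$ (with respect to the fixed orientation), two flows $f,g$ being adjacent if $\mathrm{supp}(f-g)$ is the edge set of a cycle of $G$. *)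

theory Defs
  imports "Graph_Theory.Digraph" "HOL-Library.FuncSet"
begin

section \<open>Loopless multigraphs\<close>

record ('v, 'e) pre_multigraph =
  mverts :: "'v set"
  medges :: "'e set"
  mends :: "'e \<Rightarrow> 'v set"

text \<open>Edges are named objects, so parallel edges are allowed; each has exactly two
  ends, so there are no loops.\<close>

locale multigraph =
  fixes G :: "('v, 'e) pre_multigraph"
  assumes mends_in_mverts: "e \<in> medges G \<Longrightarrow> mends G e \<subseteq> mverts G"
    and card_mends: "e \<in> medges G \<Longrightarrow> card (mends G e) = 2"

locale finite_multigraph = multigraph +
  assumes finite_mverts: "finite (mverts G)"
    and finite_medges: "finite (medges G)"

definition mdegree :: "('v, 'e) pre_multigraph \<Rightarrow> 'v \<Rightarrow> nat" where
  "mdegree G v = card {e \<in> medges G. v \<in> mends G e}"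

definition madjacent :: "('v, 'e) pre_multigraph \<Rightarrow> ('v \<times> 'v) set" where
  "madjacent G = {(u, v). \<exists>e \<in> medges G. mends G e = {u, v}}"

definition mconnected :: "('v, 'e) pre_multigraph \<Rightarrow> bool" where
  "mconnected G \<longleftrightarrow>
     mverts G \<noteq> {} \<and> (\<forall>u \<in> mverts G. \<forall>v \<in> mverts G. (u, v) \<in> (madjacent G)\<^sup>*)"

definition del_edges :: "('v, 'e) pre_multigraph \<Rightarrow> 'e set \<Rightarrow> ('v, 'e) pre_multigraph" where
  "del_edges G F = G\<lparr>medges := medges G - F\<rparr>"

text \<open>As usual, the one-vertex graph is not \<open>l\<close>-edge-connected for any \<open>l\<close>.\<close>

definition edge_connected :: "nat \<Rightarrow> ('v, 'e) pre_multigraph \<Rightarrow> bool" where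
  "edge_connected l G \<longleftrightarrow>
     card (mverts G) > 1 \<and>
     (\<forall>F. F \<subseteq> medges G \<and> finite F \<and> card F < l \<longrightarrow> mconnected (del_edges G F))"

definition msubgraph :: "('v, 'e) pre_multigraph \<Rightarrow> ('v, 'e) pre_multigraph \<Rightarrow> bool" where
  "msubgraph H G \<longleftrightarrow>
     multigraph H \<and> mverts H \<subseteq> mverts G \<and> medges H \<subseteq> medges G \<and>
     (\<forall>e \<in> medges H. mends H e = mends G e)"

text \<open>Two parallel edges form a cycle of length 2.\<close>

definition cycle_of :: "('v, 'e) pre_multigraph \<Rightarrow> ('v, 'e) pre_multigraph \<Rightarrow> bool" where
  "cycle_of G C \<longleftrightarrow>
     msubgraph C G \<and> mconnected C \<and> (\<forall>v \<in> mverts C. mdegree C v = 2)"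

section \<open>Orientations and flows\<close>

definition orientation_of :: "('v, 'e) pre_multigraph \<Rightarrow> ('v, 'e) pre_digraph \<Rightarrow> bool" where
  "orientation_of G D \<longleftrightarrow>
     verts D = mverts G \<and> arcs D = medges G \<and>
     (\<forall>e \<in> medges G. mends G e = {tail D e, head D e})"

text \<open>Maps on the edge set are represented by extensional functions, so that distinct
  flows differ on some edge.\<close>

definition int_flow :: "('v, 'e) pre_digraph \<Rightarrow> ('e \<Rightarrow> int) \<Rightarrow> bool" where
  "int_flow D f \<longleftrightarrow>
     f \<in> arcs D \<rightarrow>\<^sub>E UNIV \<and>
     (\<forall>v \<in> verts D. (\<Sum>e \<in> out_arcs D v. f e) = (\<Sum>e \<in> in_arcs D v. f e))"

definition k_flow :: "('v, 'e) pre_digraph \<Rightarrow> int \<Rightarrow> ('e \<Rightarrow> int) \<Rightarrow> bool" where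
  "k_flow D k f \<longleftrightarrow> int_flow D f \<and> (\<forall>e \<in> arcs D. \<bar>f e\<bar> < k)"

definition nowhere_zero_k_flow :: "('v, 'e) pre_digraph \<Rightarrow> int \<Rightarrow> ('e \<Rightarrow> int) \<Rightarrow> bool" where
  "nowhere_zero_k_flow D k f \<longleftrightarrow> k_flow D k f \<and> (\<forall>e \<in> arcs D. f e \<noteq> 0)"

definition flow_supp :: "('v, 'e) pre_digraph \<Rightarrow> ('e \<Rightarrow> int) \<Rightarrow> 'e set" where
  "flow_supp D f = {e \<in> arcs D. f e \<noteq> 0}"

text \<open>The reconfiguration graph of \<open>G\<close> with respect to the orientation \<open>D\<close>. It is a simple
  graph, so an edge is the set of its two ends.\<close>

definition flow_graph ::
  "('v, 'e) pre_multigraph \<Rightarrow> ('v, 'e) pre_digraph \<Rightarrow> int \<Rightarrow>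
     ('e \<Rightarrow> int, ('e \<Rightarrow> int) set) pre_multigraph" where
  "flow_graph G D k =
     \<lparr>mverts = {f. nowhere_zero_k_flow D k f},
      medges = {{f, g} | f g. nowhere_zero_k_flow D k f \<and> nowhere_zero_k_flow D k g \<and>
                  (\<exists>C. cycle_of G C \<and> flow_supp D (\<lambda>e. f e - g e) = medges C)},
      mends = (\<lambda>e. e)\<rparr>"

lemma cycle_of_medges_nonempty:
  assumes "cycle_of G C"
  shows "medges C \<noteq> {}"
  using assms by (auto simp: cycle_of_def mconnected_def mdegree_def)

text \<open>Finiteness matters: the cardinality in \<^const>\<open>mdegree\<close> would be 0 for an infinite
  set of edges.\<close>

lemma finite_multigraph_flow_graph:
  assumes G: "finite_multigraph G" and D: "orientation_of G D"
  shows "finite_multigraph (flow_graph G D k)"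
proof -
  interpret finite_multigraph G by (rule G)
  have fin: "finite {f. nowhere_zero_k_flow D k f}"
  proof (rule finite_subset)
    show "{f. nowhere_zero_k_flow D k f} \<subseteq> arcs D \<rightarrow>\<^sub>E {-k..k}"
    proof
      fix f assume "f \<in> {f. nowhere_zero_k_flow D k f}"
      then have ext: "f \<in> extensional (arcs D)" and bound: "\<And>e. e \<in> arcs D \<Longrightarrow> \<bar>f e\<bar> < k"
        by (auto simp: nowhere_zero_k_flow_def k_flow_def int_flow_def PiE_iff)
      have "f e \<in> {-k..k}" if "e \<in> arcs D" for e
        using bound[OF that] by auto
      with ext show "f \<in> arcs D \<rightarrow>\<^sub>E {-k..k}"
        by (simp add: PiE_iff)
    qed
    show "finite (arcs D \<rightarrow>\<^sub>E {-k..k})"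
      using D finite_medges by (auto simp: orientation_of_def intro: finite_PiE)
  qed
  have "medges (flow_graph G D k) \<subseteq> Pow {f. nowhere_zero_k_flow D k f}"
    by (auto simp: flow_graph_def)
  then have fin': "finite (medges (flow_graph G D k))"
    using fin by (meson finite_Pow_iff finite_subset)
  have edge: "e \<subseteq> {f. nowhere_zero_k_flow D k f} \<and> card e = 2"
    if "e \<in> medges (flow_graph G D k)" for e
  proof -
    from that obtain f g C where e: "e = {f, g}"
      and f: "nowhere_zero_k_flow D k f" and g: "nowhere_zero_k_flow D k g"
      and C: "cycle_of G C" "flow_supp D (\<lambda>e. f e - g e) = medges C"
      by (auto simp: flow_graph_def)
    have "f \<noteq> g"
      using cycle_of_medges_nonempty[OF C(1)] C(2) by (auto simp: flow_supp_def)
    then show ?thesis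
      using e f g by simp
  qed
  have "mverts (flow_graph G D k) = {f. nowhere_zero_k_flow D k f}"
    and "\<And>e. mends (flow_graph G D k) e = e"
    by (simp_all add: flow_graph_def)
  then show ?thesis
    using fin fin' edge by unfold_locales simp_all
qed

end

theory Submission
  imports Defs "HOL-Combinatorics.Orbits"
begin

text \<open>Reversing the arcs on which \<open>f\<close> is negative identifies the reconfiguration graphs of the
  two orientations, so \<open>f\<close> may be assumed positive. By conservation every vertex then has an
  outgoing arc, so there is a directed cycle \<open>C\<close>. Subtracting \<open>k\<close> along \<open>C\<close> moves the values of
  \<open>f\<close> on \<open>C\<close> from \<open>{1..k-1}\<close> to \<open>{-(k-1)..-1}\<close>, which gives another nowhere-zero \<open>k\<close>-flow,
  differing from \<open>f\<close> exactly on \<open>C\<close>.\<close>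

lemma cyclic_on_bij_betw:
  assumes "cyclic_on f S"
  shows "bij_betw f S S"
proof -
  have "S \<subseteq> f ` S"
  proof
    fix s assume "s \<in> S"
    with assms have "s \<in> orbit f s" "orbit f s = S"
      by (auto simp: cyclic_on_alldef)
    then show "s \<in> f ` S"
      using \<open>s \<in> S\<close> by (metis imageI orbit.cases)
  qed
  then have "f ` S = S"
    using cyclic_on_inI[OF assms] by blast
  then show ?thesis
    using finite_cyclic_on[OF assms] by (simp add: bij_betw_def eq_card_imp_inj_on)
qed

lemma finite_invariant_set_cyclic_on:
  assumes "finite V" "V \<noteq> {}" "f ` V \<subseteq> V"
  obtains S where "S \<subseteq> V" "cyclic_on f S"
proof -
  let ?invariant = "{S. S \<subseteq> V \<and> S \<noteq> {} \<and> f ` S \<subseteq> S}"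
  have "finite ?invariant" "?invariant \<noteq> {}"
    using assms by auto
  then obtain S where S: "S \<in> ?invariant"
    and minimal: "\<And>T. T \<in> ?invariant \<Longrightarrow> T \<subseteq> S \<Longrightarrow> S = T"
    by (metis (lifting) finite_has_minimal)
  then obtain s where "s \<in> S"
    by blast
  have "orbit f s \<subseteq> S"
  proof
    fix t assume "t \<in> orbit f s"
    then show "t \<in> S"
      using S \<open>s \<in> S\<close> by induction auto
  qed
  moreover from this have "orbit f s \<in> ?invariant"
    using S orbit_nonempty[of f s] by (auto intro: orbit.step)
  ultimately have "S = orbit f s"
    using minimal by blast
  then have "cyclic_on f S"
    using \<open>s \<in> S\<close> by (intro cyclic_on_singleI)
  with S show thesis
    by (intro that) auto
qed

lemma mconnected_if_cyclic_on:
  assumes cyclic: "cyclic_on f (mverts G)"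
    and adjacent: "\<And>v. v \<in> mverts G \<Longrightarrow> (v, f v) \<in> madjacent G"
  shows "mconnected G"
  unfolding mconnected_def
proof (intro conjI ballI)
  show "mverts G \<noteq> {}"
    using cyclic by (auto simp: cyclic_on_def)
next
  fix u v assume u: "u \<in> mverts G" and "v \<in> mverts G"
  then have "v \<in> orbit f u"
    using orbit_cyclic_eq3[OF cyclic] by blast
  then show "(u, v) \<in> (madjacent G)\<^sup>*"
  proof induction
    case base
    show ?case
      using adjacent[OF u] by blast
  next
    case (step w)
    then have "w \<in> mverts G"
      using orbit_cyclic_eq3[OF cyclic u] by blast
    then show ?case
      using step.IH adjacent by (blast intro: rtrancl_into_rtrancl)
  qed
qed

lemma (in multigraph) mdegree_eq_2_if_bij_betw:
  assumes ends: "\<And>e. e \<in> medges G \<Longrightarrow> mends G e = {s e, t e}"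
    and s: "bij_betw s (medges G) (mverts G)"
    and t: "bij_betw t (medges G) (mverts G)"
    and v: "v \<in> mverts G"
  shows "mdegree G v = 2"
proof -
  have preimage: "\<exists>a \<in> medges G. \<forall>e \<in> medges G. r e = v \<longleftrightarrow> e = a"
    if bij: "bij_betw r (medges G) (mverts G)" for r
  proof -
    have "v \<in> r ` medges G"
      using bij v by (simp add: bij_betw_def)
    then obtain a where a: "a \<in> medges G" "v = r a" ..
    then have "\<forall>e \<in> medges G. r e = v \<longleftrightarrow> e = a"
      using bij by (auto simp: bij_betw_def dest: inj_onD)
    then show ?thesis
      using a(1) by blast
  qed
  obtain a where a: "a \<in> medges G" "\<forall>e \<in> medges G. s e = v \<longleftrightarrow> e = a"
    using preimage[OF s] by blast
  obtain b where b: "b \<in> medges G" "\<forall>e \<in> medges G. t e = v \<longleftrightarrow> e = b"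
    using preimage[OF t] by blast
  have "{e \<in> medges G. v \<in> mends G e} = {a, b}"
    using ends a b by auto
  moreover have "a \<noteq> b"
  proof
    assume "a = b"
    then have "mends G a = {v}"
      using ends a b by auto
    then show False
      using card_mends[OF a(1)] by simp
  qed
  ultimately show ?thesis
    by (simp add: mdegree_def)
qed

lemma (in finite_multigraph) mdegree_ge_1:
  assumes "e \<in> medges G" "v \<in> mends G e"
  shows "mdegree G v \<ge> 1"
proof -
  have "{e \<in> medges G. v \<in> mends G e} \<noteq> {}"
    using assms by blast
  then show ?thesis
    using finite_medges by (simp add: mdegree_def Suc_le_eq card_gt_0_iff)
qed

lemma edge_connected_incident_edge:
  assumes "edge_connected l G" "l > 0" "v \<in> mverts G"
  obtains e where "e \<in> medges G" "v \<in> mends G e"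
proof -
  have "mconnected (del_edges G {})"
    using assms by (auto simp: edge_connected_def)
  moreover obtain u where "u \<in> mverts G" "u \<noteq> v"
    using assms by (metis card_le_Suc0_iff_eq card.infinite edge_connected_def
        less_nat_zero_code linorder_not_less One_nat_def)
  ultimately have "(v, u) \<in> (madjacent G)\<^sup>*" "u \<noteq> v"
    using assms(3) by (auto simp: mconnected_def del_edges_def)
  then obtain w where "(v, w) \<in> madjacent G"
    by (metis converse_rtranclE)
  then show thesis
    using that by (auto simp: madjacent_def)
qed

definition directed_cycle_of ::
  "('v, 'e) pre_multigraph \<Rightarrow> ('v, 'e) pre_digraph \<Rightarrow> ('v, 'e) pre_multigraph \<Rightarrow> bool" where
  "directed_cycle_of G D C \<longleftrightarrow>
     cycle_of G C \<and>
     bij_betw (tail D) (medges C) (mverts C) \<and> bij_betw (head D) (medges C) (mverts C)"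

lemma directed_cycle_of_medges_subset:
  assumes "directed_cycle_of G D C" "orientation_of G D"
  shows "medges C \<subseteq> arcs D"
  using assms by (auto simp: directed_cycle_of_def cycle_of_def msubgraph_def orientation_of_def)

lemma directed_cycle_ofI:
  assumes D: "orientation_of G D"
    and subgraph: "msubgraph C G" and connected: "mconnected C"
    and bij: "bij_betw (tail D) (medges C) (mverts C)" "bij_betw (head D) (medges C) (mverts C)"
  shows "directed_cycle_of G D C"
proof -
  interpret C: multigraph C
    using subgraph by (simp add: msubgraph_def)
  have "mends C e = {tail D e, head D e}" if "e \<in> medges C" for e
    using that D subgraph by (auto simp: orientation_of_def msubgraph_def)
  then have "mdegree C v = 2" if "v \<in> mverts C" for v
    using C.mdegree_eq_2_if_bij_betw bij that by blast
  then show ?thesis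
    using subgraph connected bij by (simp add: directed_cycle_of_def cycle_of_def)
qed

lemma (in multigraph) directed_cycle_of_cyclic_on:
  assumes D: "orientation_of G D"
    and S: "S \<subseteq> mverts G"
    and out_arc: "\<And>v. v \<in> S \<Longrightarrow> out_arc v \<in> out_arcs D v"
    and cyclic: "cyclic_on (head D \<circ> out_arc) S"
  shows "directed_cycle_of G D \<lparr>mverts = S, medges = out_arc ` S, mends = mends G\<rparr>"
    (is "directed_cycle_of G D ?C")
proof (rule directed_cycle_ofI[OF D])
  have edge: "out_arc v \<in> medges G" and tail: "tail D (out_arc v) = v" if "v \<in> S" for v
    using out_arc[OF that] D by (auto simp: orientation_of_def)
  have ends: "mends G (out_arc v) = {v, head D (out_arc v)}" if "v \<in> S" for v
    using D edge[OF that] tail[OF that] by (auto simp: orientation_of_def)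
  have "multigraph ?C"
  proof
    show "mends ?C e \<subseteq> mverts ?C" if "e \<in> medges ?C" for e
      using that ends cyclic_on_inI[OF cyclic] by auto
    show "card (mends ?C e) = 2" if "e \<in> medges ?C" for e
      using that edge card_mends by auto
  qed
  then show "msubgraph ?C G"
    using S edge by (auto simp: msubgraph_def)
  show "mconnected ?C"
  proof (rule mconnected_if_cyclic_on)
    show "cyclic_on (head D \<circ> out_arc) (mverts ?C)"
      using cyclic by simp
    show "(v, (head D \<circ> out_arc) v) \<in> madjacent ?C" if "v \<in> mverts ?C" for v
      using that ends by (auto simp: madjacent_def)
  qed
  show "bij_betw (tail D) (medges ?C) (mverts ?C)"
    using tail by (intro bij_betw_byWitness[where f' = out_arc]) auto
  have "bij_betw out_arc S (out_arc ` S)"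
    using tail by (metis bij_betw_imageI inj_onI)
  then show "bij_betw (head D) (medges ?C) (mverts ?C)"
    using cyclic_on_bij_betw[OF cyclic] bij_betw_comp_iff by fastforce
qed

lemma (in finite_multigraph) exists_directed_cycle:
  assumes D: "orientation_of G D"
    and nonempty: "mverts G \<noteq> {}"
    and out: "\<And>v. v \<in> mverts G \<Longrightarrow> out_arcs D v \<noteq> {}"
  obtains C where "directed_cycle_of G D C"
proof -
  have "\<forall>v \<in> mverts G. \<exists>e. e \<in> out_arcs D v"
    using out by blast
  then obtain out_arc where out_arc: "out_arc v \<in> out_arcs D v" if "v \<in> mverts G" for v
    by (metis bchoice)
  have "head D e \<in> mverts G" if "e \<in> arcs D" for e
    using that D mends_in_mverts[of e] by (auto simp: orientation_of_def)
  then have "(head D \<circ> out_arc) ` mverts G \<subseteq> mverts G"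
    using out_arc by fastforce
  then obtain S where "S \<subseteq> mverts G" "cyclic_on (head D \<circ> out_arc) S"
    using finite_invariant_set_cyclic_on[OF finite_mverts nonempty] by blast
  then show thesis
    using that directed_cycle_of_cyclic_on[OF D] out_arc by blast
qed

definition incidence :: "('v, 'e) pre_digraph \<Rightarrow> 'v \<Rightarrow> 'e \<Rightarrow> int" where
  "incidence D v e = of_bool (tail D e = v) - of_bool (head D e = v)"

lemma int_flow_iff_incidence:
  assumes "finite (arcs D)"
  shows "int_flow D f \<longleftrightarrow>
    f \<in> extensional (arcs D) \<and> (\<forall>v \<in> verts D. (\<Sum>e \<in> arcs D. f e * incidence D v e) = 0)"
proof -
  have "(\<Sum>e \<in> arcs D. f e * incidence D v e)
      = (\<Sum>e \<in> out_arcs D v. f e) - (\<Sum>e \<in> in_arcs D v. f e)" for v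
  proof -
    have "(\<Sum>e \<in> arcs D. f e * incidence D v e)
        = (\<Sum>e \<in> arcs D. if tail D e = v then f e else 0)
          - (\<Sum>e \<in> arcs D. if head D e = v then f e else 0)"
      by (subst sum_subtractf[symmetric], rule sum.cong)
        (auto simp: incidence_def algebra_simps)
    also have "\<dots> = (\<Sum>e \<in> out_arcs D v. f e) - (\<Sum>e \<in> in_arcs D v. f e)"
      using assms by (simp add: sum.inter_filter out_arcs_def in_arcs_def)
    finally show ?thesis .
  qed
  then show ?thesis
    by (auto simp: int_flow_def PiE_iff)
qed

lemma sum_incidence_directed_cycle:
  assumes "directed_cycle_of G D C"
  shows "(\<Sum>e \<in> medges C. incidence D v e) = 0"
proof -
  have "(\<Sum>e \<in> medges C. of_bool (tail D e = v)) = (\<Sum>u \<in> mverts C. of_bool (u = v) :: int)"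
    and "(\<Sum>e \<in> medges C. of_bool (head D e = v)) = (\<Sum>u \<in> mverts C. of_bool (u = v) :: int)"
    using assms sum.reindex_bij_betw[of _ "medges C" "mverts C" "\<lambda>u. of_bool (u = v) :: int"]
    by (auto simp: directed_cycle_of_def)
  then show ?thesis
    by (simp add: incidence_def sum_subtractf)
qed

lemma int_flow_add_directed_cycle:
  assumes fin: "finite (arcs D)" and D: "orientation_of G D"
    and f: "int_flow D f" and C: "directed_cycle_of G D C"
  shows "int_flow D (\<lambda>e. f e + c * of_bool (e \<in> medges C))"
proof -
  note C_arcs = directed_cycle_of_medges_subset[OF C D]
  have "(\<Sum>e \<in> arcs D. (f e + c * of_bool (e \<in> medges C)) * incidence D v e) = 0"
    if "v \<in> verts D" for v
  proof -
    have "(\<Sum>e \<in> arcs D. (f e + c * of_bool (e \<in> medges C)) * incidence D v e)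
        = (\<Sum>e \<in> arcs D. f e * incidence D v e)
          + c * (\<Sum>e \<in> arcs D. if e \<in> medges C then incidence D v e else 0)"
      by (auto simp: sum_distrib_left sum.distrib[symmetric] algebra_simps intro!: sum.cong)
    also have "(\<Sum>e \<in> arcs D. if e \<in> medges C then incidence D v e else 0)
        = (\<Sum>e \<in> medges C. incidence D v e)"
      using fin C_arcs by (simp add: sum.inter_restrict[symmetric] Int_absorb1)
    finally show ?thesis
      using f that sum_incidence_directed_cycle[OF C] by (simp add: int_flow_iff_incidence[OF fin])
  qed
  moreover have "(\<lambda>e. f e + c * of_bool (e \<in> medges C)) \<in> extensional (arcs D)"
    using f C_arcs by (auto simp: int_flow_def PiE_iff extensional_def)
  ultimately show ?thesis
    by (simp add: int_flow_iff_incidence[OF fin])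
qed

lemma positive_flow_out_arcs_empty_iff:
  assumes "finite (arcs D)" "int_flow D f" "\<And>e. e \<in> arcs D \<Longrightarrow> f e > 0" "v \<in> verts D"
  shows "out_arcs D v = {} \<longleftrightarrow> in_arcs D v = {}"
proof -
  have "sum f A = 0 \<longleftrightarrow> A = {}" if "A \<subseteq> arcs D" for A
    using that assms(1,3) sum_pos[of A f] by (metis finite_subset less_irrefl subsetD sum.empty)
  moreover have "sum f (out_arcs D v) = sum f (in_arcs D v)"
    using assms(2,4) by (simp add: int_flow_def)
  ultimately show ?thesis
    by (metis in_arcs_in_arcs out_arcs_in_arcs subsetI)
qed

lemma (in finite_multigraph) positive_flow_directed_cycle:
  assumes D: "orientation_of G D"
    and conn: "edge_connected l G" "l > 0"
    and f: "int_flow D f" "\<And>e. e \<in> arcs D \<Longrightarrow> f e > 0"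
  obtains C where "directed_cycle_of G D C"
proof -
  have "out_arcs D v \<noteq> {}" if v: "v \<in> mverts G" for v
  proof -
    obtain e where "e \<in> medges G" "v \<in> mends G e"
      using edge_connected_incident_edge[OF conn v] .
    then have "out_arcs D v \<noteq> {} \<or> in_arcs D v \<noteq> {}"
      using D by (auto simp: orientation_of_def)
    moreover have "finite (arcs D)" "v \<in> verts D"
      using D v finite_medges by (auto simp: orientation_of_def)
    ultimately show ?thesis
      using positive_flow_out_arcs_empty_iff[of D f v] f by blast
  qed
  moreover have "mverts G \<noteq> {}"
    using conn by (auto simp: edge_connected_def)
  ultimately show thesis
    using exists_directed_cycle[OF D] that by blast
qed

definition flow_adjacent ::
  "('v, 'e) pre_multigraph \<Rightarrow> ('v, 'e) pre_digraph \<Rightarrow> int \<Rightarrow> ('e \<Rightarrow> int) \<Rightarrow> ('e \<Rightarrow> int) \<Rightarrow> bool"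
where
  "flow_adjacent G D k f g \<longleftrightarrow>
     nowhere_zero_k_flow D k f \<and> nowhere_zero_k_flow D k g \<and>
     (\<exists>C. cycle_of G C \<and> flow_supp D (\<lambda>e. f e - g e) = medges C)"

lemma mdegree_flow_graph_ge_1:
  assumes "finite_multigraph G" "orientation_of G D" "flow_adjacent G D k f g"
  shows "mdegree (flow_graph G D k) f \<ge> 1"
proof (rule finite_multigraph.mdegree_ge_1)
  show "finite_multigraph (flow_graph G D k)"
    using assms by (intro finite_multigraph_flow_graph)
  show "{f, g} \<in> medges (flow_graph G D k)" "f \<in> mends (flow_graph G D k) {f, g}"
    using assms(3) by (auto simp: flow_graph_def flow_adjacent_def)
qed

lemma flow_adjacent_subtract_directed_cycle:
  assumes fin: "finite (arcs D)" and D: "orientation_of G D"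
    and f: "nowhere_zero_k_flow D k f" and C: "directed_cycle_of G D C"
    and pos: "\<And>e. e \<in> medges C \<Longrightarrow> f e > 0"
  shows "flow_adjacent G D k f (\<lambda>e. f e - k * of_bool (e \<in> medges C))"
proof -
  let ?g = "\<lambda>e. f e - k * of_bool (e \<in> medges C)"
  note C_arcs = directed_cycle_of_medges_subset[OF C D]
  have f_bounds: "f e \<noteq> 0" "\<bar>f e\<bar> < k" if "e \<in> arcs D" for e
    using f that by (auto simp: nowhere_zero_k_flow_def k_flow_def)
  have "int_flow D ?g"
    using int_flow_add_directed_cycle[OF fin D _ C, of f "-k"] f
    by (simp add: nowhere_zero_k_flow_def k_flow_def)
  moreover have "?g e \<noteq> 0" "\<bar>?g e\<bar> < k" if "e \<in> arcs D" for e
    using f_bounds[OF that] pos[of e] by (auto split: split_of_bool)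
  ultimately have "nowhere_zero_k_flow D k ?g"
    by (simp add: nowhere_zero_k_flow_def k_flow_def)
  moreover have "flow_supp D (\<lambda>e. f e - ?g e) = medges C"
    using C_arcs f_bounds by (fastforce simp: flow_supp_def)
  moreover have "cycle_of G C"
    using C by (simp add: directed_cycle_of_def)
  ultimately show ?thesis
    using f by (auto simp: flow_adjacent_def)
qed

definition reverse_arcs :: "'e set \<Rightarrow> ('v, 'e) pre_digraph \<Rightarrow> ('v, 'e) pre_digraph" where
  "reverse_arcs A D = D\<lparr>tail := (\<lambda>e. if e \<in> A then head D e else tail D e),
                         head := (\<lambda>e. if e \<in> A then tail D e else head D e)\<rparr>"

definition negate_on :: "'e set \<Rightarrow> ('e \<Rightarrow> int) \<Rightarrow> 'e \<Rightarrow> int" where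
  "negate_on A f e = (if e \<in> A then - f e else f e)"

lemma reverse_arcs_simps [simp]:
  "verts (reverse_arcs A D) = verts D"
  "arcs (reverse_arcs A D) = arcs D"
  by (simp_all add: reverse_arcs_def)

lemma negate_on_negate_on [simp]: "negate_on A (negate_on A f) = f"
  by (simp add: negate_on_def fun_eq_iff)

lemma orientation_of_reverse_arcs [simp]:
  "orientation_of G (reverse_arcs A D) \<longleftrightarrow> orientation_of G D"
  by (auto simp: orientation_of_def reverse_arcs_def insert_commute)

lemma int_flow_reverse_arcs:
  assumes fin: "finite (arcs D)" and A: "A \<subseteq> arcs D"
  shows "int_flow (reverse_arcs A D) (negate_on A f) \<longleftrightarrow> int_flow D f"
proof -
  have "negate_on A f e * incidence (reverse_arcs A D) v e = f e * incidence D v e" for v e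
    by (simp add: negate_on_def incidence_def reverse_arcs_def algebra_simps)
  moreover have "negate_on A f \<in> extensional (arcs D) \<longleftrightarrow> f \<in> extensional (arcs D)"
    using A by (auto simp: negate_on_def extensional_def)
  ultimately show ?thesis
    using fin by (simp add: int_flow_iff_incidence)
qed

lemma nowhere_zero_k_flow_reverse_arcs:
  assumes "finite (arcs D)" "A \<subseteq> arcs D"
  shows "nowhere_zero_k_flow (reverse_arcs A D) k (negate_on A f) \<longleftrightarrow> nowhere_zero_k_flow D k f"
  using int_flow_reverse_arcs[OF assms]
  by (simp add: nowhere_zero_k_flow_def k_flow_def negate_on_def)

lemma flow_adjacent_reverse_arcs:
  assumes "finite (arcs D)" "A \<subseteq> arcs D"
  shows "flow_adjacent G (reverse_arcs A D) k (negate_on A f) (negate_on A g) \<longleftrightarrow>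
    flow_adjacent G D k f g"
proof -
  have "flow_supp (reverse_arcs A D) (\<lambda>e. negate_on A f e - negate_on A g e)
      = flow_supp D (\<lambda>e. f e - g e)"
    by (auto simp: flow_supp_def negate_on_def)
  then show ?thesis
    using nowhere_zero_k_flow_reverse_arcs[OF assms] by (simp add: flow_adjacent_def)
qed

lemma (in finite_multigraph) nowhere_zero_k_flow_has_neighbour:
  assumes D: "orientation_of G D" and conn: "edge_connected l G" "l > 0"
    and f: "nowhere_zero_k_flow D k f"
  obtains g where "flow_adjacent G D k f g"
proof -
  let ?A = "{e \<in> arcs D. f e < 0}"
  let ?D = "reverse_arcs ?A D" and ?f = "negate_on ?A f"
  have fin: "finite (arcs D)"
    using D finite_medges by (simp add: orientation_of_def)
  have D_rev: "orientation_of G ?D"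
    using D by simp
  have f_rev: "nowhere_zero_k_flow ?D k ?f"
    using f nowhere_zero_k_flow_reverse_arcs[OF fin, of ?A] by simp
  have pos: "?f e > 0" if "e \<in> arcs D" for e
    using f that by (auto simp: negate_on_def nowhere_zero_k_flow_def not_less less_le)
  obtain C where C: "directed_cycle_of G ?D C"
    using positive_flow_directed_cycle[OF D_rev conn, of ?f] f_rev pos
    by (auto simp: nowhere_zero_k_flow_def k_flow_def)
  define g where "g e = ?f e - k * of_bool (e \<in> medges C)" for e
  have "flow_adjacent G ?D k ?f g"
    unfolding g_def using fin pos directed_cycle_of_medges_subset[OF C D_rev]
    by (intro flow_adjacent_subtract_directed_cycle D_rev f_rev C) auto
  then have "flow_adjacent G D k f (negate_on ?A g)"
    using flow_adjacent_reverse_arcs[OF fin, of ?A G k f "negate_on ?A g"] by simp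
  then show thesis
    by (rule that)
qed

theorem theorem3p4:
  fixes G :: "('v, 'e) pre_multigraph"
    and D :: "('v, 'e) pre_digraph"
    and k :: int
  assumes "finite_multigraph G"
    and "edge_connected 2 G"
    and "orientation_of G D"
    and "k \<ge> 2"
    and "mverts (flow_graph G D k) \<noteq> {}"
  shows "\<forall>f \<in> mverts (flow_graph G D k). mdegree (flow_graph G D k) f \<ge> 1"
proof
  fix f assume "f \<in> mverts (flow_graph G D k)"
  then have "nowhere_zero_k_flow D k f"
    by (simp add: flow_graph_def)
  then obtain g where "flow_adjacent G D k f g"
    using finite_multigraph.nowhere_zero_k_flow_has_neighbour[OF assms(1,3,2)] by auto
  then show "mdegree (flow_graph G D k) f \<ge> 1"
    by (rule mdegree_flow_graph_ge_1[OF assms(1,3)])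
qed

end
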